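(* For every integer $r > 1$, every $\alpha \in (1, 2r-1)$ and every $\varepsilon > 0$ there is a finite graph $G$ all of whose vertex degrees lie in $\{2, \ldots, 2r\}$ such that $|\lambda_1(B_G) - \alpha| < \varepsilon$, where $\lambda_1(B_G)$ is the leading eigenvalue of the non-backtracking matrix $B_G$ of $G$.
   Context: Graphs are undirected. The non-backtracking matrix $B_G$ of a finite graph $G$ is the $0$-$1$ matrix indexed by the oriented edges of $G$ (each edge gives two oriented edges, reversals of each other), with $(B_G)_{e,f}=1$ if the head of $e$ equals the tail of $f$ and $f$ is not the reversal of $e$, and $(B_G)_{e,f}=0$ otherwise. Its leading eigenvalue $\lambda_1(B_G)$ is its Perron eigenvalue, i.e. the largest real eigenvalue, equal to the spectral radius of $B_G$. *)

theory Defs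
  imports "Graph_Theory.Pair_Digraph" "Jordan_Normal_Form.Char_Poly"
begin

text \<open>
  Finite simple undirected graphs are those satisfying \<^locale>\<open>pair_graph\<close>. Such a graph is
  represented by its vertex set and its symmetric, irreflexive set of arcs, so the arcs are exactly
  the oriented edges, \<^term>\<open>prod.swap\<close> is the reversal, and the degree of a vertex
  is its \<^const>\<open>out_degree\<close>.
\<close>

definition nb_adj :: "'a \<times> 'a \<Rightarrow> 'a \<times> 'a \<Rightarrow> bool" where
  "nb_adj e f \<longleftrightarrow> snd e = fst f \<and> f \<noteq> prod.swap e"

text \<open>
  Matrices are indexed by natural numbers, hence an arbitrary but fixed enumeration of the oriented
  edges. The eigenvalues do not depend on it, see \<open>eigenvalue_nb_matrix_iff\<close> below.
\<close>

definition arc_enum :: "'a pair_pre_digraph \<Rightarrow> ('a \<times> 'a) list" where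
  "arc_enum G = (SOME es. distinct es \<and> set es = parcs G)"

definition nb_matrix :: "'a pair_pre_digraph \<Rightarrow> real mat" where
  "nb_matrix G = (let es = arc_enum G; n = length es in
     mat n n (\<lambda>(i, j). if nb_adj (es ! i) (es ! j) then 1 else 0))"

text \<open>
  The set below is finite, and by the Perron--Frobenius theorem it is nonempty and its maximum is
  the spectral radius as soon as the graph has an edge. For a graph without edges the value is
  unspecified.
\<close>

definition leading_eigenvalue :: "real mat \<Rightarrow> real" where
  "leading_eigenvalue A = Max {x. eigenvalue A x}"

lemma arc_enum:
  assumes "finite (parcs G)"
  shows "distinct (arc_enum G)" "set (arc_enum G) = parcs G"
proof -
  have "\<exists>es. distinct es \<and> set es = parcs G"
    using finite_distinct_list[OF assms] by blast
  from someI_ex[OF this] show "distinct (arc_enum G)" "set (arc_enum G) = parcs G"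
    by (simp_all add: arc_enum_def)
qed

lemma eigenvalue_nb_matrix_iff:
  assumes "finite (parcs G)"
  shows "eigenvalue (nb_matrix G) x \<longleftrightarrow>
    (\<exists>v. (\<exists>e\<in>parcs G. v e \<noteq> 0) \<and>
         (\<forall>e\<in>parcs G. (\<Sum>f\<in>parcs G. if nb_adj e f then v f else 0) = x * v e))"
    (is "_ \<longleftrightarrow> ?R")
proof -
  define es n where "es = arc_enum G" and "n = length es"
  have d: "distinct es" and s: "set es = parcs G"
    using arc_enum[OF assms] by (simp_all add: es_def)
  have bij: "bij_betw ((!) es) {..<n} (parcs G)"
    using bij_betw_nth[OF d] by (auto simp: n_def s)
  have B: "nb_matrix G = mat n n (\<lambda>(i, j). if nb_adj (es ! i) (es ! j) then 1 else 0)"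
    by (simp add: nb_matrix_def Let_def es_def n_def)
  have all: "(\<forall>e\<in>parcs G. P e) \<longleftrightarrow> (\<forall>i<n. P (es ! i))" for P
    using s by (metis in_set_conv_nth n_def)
  have ex: "(\<exists>e\<in>parcs G. P e) \<longleftrightarrow> (\<exists>i<n. P (es ! i))" for P
    using all[of "\<lambda>e. \<not> P e"] by blast
  have row: "(nb_matrix G *\<^sub>v w) $ i =
      (\<Sum>f\<in>parcs G. if nb_adj (es ! i) f then u f else 0)"
    if "w \<in> carrier_vec n" "\<forall>j<n. w $ j = u (es ! j)" "i < n" for w u i
  proof -
    have "(nb_matrix G *\<^sub>v w) $ i =
        (\<Sum>j<n. if nb_adj (es ! i) (es ! j) then u (es ! j) else 0)"
      using that by (auto simp: B scalar_prod_def lessThan_atLeast0 intro!: sum.cong)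
    then show ?thesis
      using sum.reindex_bij_betw[OF bij, of "\<lambda>f. if nb_adj (es ! i) f then u f else 0"] by simp
  qed
  have dim: "dim_row (nb_matrix G) = n" by (simp add: B)
  have key: "eigenvector (nb_matrix G) w x \<longleftrightarrow>
      (\<exists>e\<in>parcs G. u e \<noteq> 0) \<and>
      (\<forall>e\<in>parcs G. (\<Sum>f\<in>parcs G. if nb_adj e f then u f else 0) = x * u e)"
    if w: "w \<in> carrier_vec n" "\<forall>j<n. w $ j = u (es ! j)" for w u
  proof -
    have "w \<noteq> 0\<^sub>v n \<longleftrightarrow> (\<exists>i<n. u (es ! i) \<noteq> 0)"
      using w by (auto simp: vec_eq_iff)
    moreover have "nb_matrix G *\<^sub>v w = x \<cdot>\<^sub>v w \<longleftrightarrow>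
        (\<forall>i<n. (nb_matrix G *\<^sub>v w) $ i = x * u (es ! i))"
      using w dim by (auto simp: vec_eq_iff)
    ultimately show ?thesis
      unfolding eigenvector_def dim all ex using w row[OF w] by simp
  qed
  show ?thesis
  proof
    assume "eigenvalue (nb_matrix G) x"
    then obtain w where ev: "eigenvector (nb_matrix G) w x"
      by (auto simp: eigenvalue_def)
    then have w: "w \<in> carrier_vec n" by (simp add: eigenvector_def dim)
    define u where "u e = w $ inv_into {..<n} ((!) es) e" for e
    have "\<forall>j<n. w $ j = u (es ! j)"
      using bij by (auto simp: u_def bij_betw_def inv_into_f_f)
    from key[OF w this] ev show ?R by blast
  next
    assume ?R
    then obtain u where "(\<exists>e\<in>parcs G. u e \<noteq> 0) \<and>
      (\<forall>e\<in>parcs G. (\<Sum>f\<in>parcs G. if nb_adj e f then u f else 0) = x * u e)" by blast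
    moreover have "vec n (\<lambda>j. u (es ! j)) \<in> carrier_vec n"
      "\<forall>j<n. vec n (\<lambda>j. u (es ! j)) $ j = u (es ! j)" by simp_all
    ultimately show "eigenvalue (nb_matrix G) x"
      using key unfolding eigenvalue_def by blast
  qed
qed

end

theory Submission
  imports Defs "Jordan_Normal_Form.Spectral_Radius" "HOL-Library.Nat_Bijection"
begin

text \<open>
  The graphs are chains of \<open>n + 1\<close> layers. Every layer is a copy of the same vertex set; layer \<open>i\<close>
  carries a \<open>j i\<close>-regular graph, and consecutive layers are joined by the identity matching. So every
  vertex of layer \<open>i\<close> has \<open>j i\<close> neighbours in its layer and one in each adjacent layer, and the problem
  becomes the choice of the digits \<open>j i\<close>.

  A positive eigenvector of the non-backtracking matrix \<open>B\<close> that is constant on each class of arcs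
  (up, down, and inside a given layer) determines the leading eigenvalue. Look at the arcs leaving a
  vertex and normalise the sum of their values to \<open>1\<close>. For the eigenvalue \<open>\<mu>\<close>, each arc inside the
  layer has the share \<open>1 / (\<mu> + 1)\<close>, because it has the same value as its reversal. If the arc to the
  next layer has the share \<open>x\<close>, then the eigenvalue equation forces the share of the reversed arc at
  its own tail, so that there the arcs other than this one have the share
  \<open>\<mu>\<^sup>2 x / (1 + (\<mu>\<^sup>2 - 1) x)\<close> left. Hence the forward shares \<open>x\<^sub>i\<close> obey a digit recursion,
  \<open>remainder\<close> below: start with \<open>1\<close>, subtract \<open>j 0 / (\<mu> + 1)\<close>, transform, subtract
  \<open>j 1 / (\<mu> + 1)\<close>, and so on. The chain closes up after layer \<open>n\<close>, with \<open>\<mu>\<close> as leading eigenvalue,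
  as soon as \<open>x\<^sub>n = 0\<close> and the earlier shares are positive.

  Given \<open>\<alpha>\<close>, the greedy choice of digits keeps all shares for \<open>\<mu> = \<alpha>\<close> in \<open>[0, 1 / (\<alpha> + 1))\<close>, and
  \<open>\<alpha> < 2 r - 1\<close> is just what keeps the degrees at most \<open>2 r\<close> (\<open>ex_greedy_digits\<close>). On that interval the
  transformation expands distances, so for \<open>\<beta> < \<alpha>\<close> and the same digits, where the first share is
  already smaller, the shares drift away from those of \<open>\<alpha>\<close> until one of them is at most \<open>0\<close>
  (\<open>remainder_reaches_zero\<close>). By the intermediate value theorem this share vanishes at some
  \<open>\<mu>\<close> between \<open>\<beta>\<close> and \<open>\<alpha>\<close> (\<open>ex_terminating_base\<close>); the chain is cut at this layer, and \<open>\<beta>\<close> may be as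
  close to \<open>\<alpha>\<close> as desired.
\<close>

section \<open>Recognising the leading eigenvalue\<close>

text \<open>
  A positive eigenvector \<open>v\<close> dominates every other eigenvector \<open>w\<close>: comparing at an arc where
  \<open>\<bar>w e\<bar> / v e\<close> is largest bounds the eigenvalue of \<open>w\<close> by that of \<open>v\<close>.
\<close>

lemma leading_eigenvalue_eqI:
  fixes v :: "'a \<times> 'a \<Rightarrow> real"
  assumes fin: "finite (parcs G)" and ne: "parcs G \<noteq> {}"
    and pos: "\<And>e. e \<in> parcs G \<Longrightarrow> v e > 0"
    and eig: "\<And>e. e \<in> parcs G \<Longrightarrow>
      (\<Sum>f\<in>parcs G. if nb_adj e f then v f else 0) = \<mu> * v e"
  shows "leading_eigenvalue (nb_matrix G) = \<mu>"
proof -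
  have "nb_matrix G \<in> carrier_mat (length (arc_enum G)) (length (arc_enum G))"
    by (simp add: nb_matrix_def Let_def)
  from card_finite_spectrum(1)[OF this] have "finite {x. eigenvalue (nb_matrix G) x}"
    by (simp add: spectrum_def)
  moreover have "eigenvalue (nb_matrix G) \<mu>"
    unfolding eigenvalue_nb_matrix_iff[OF fin] using ne pos eig
    by (metis all_not_in_conv less_irrefl)
  moreover have "x \<le> \<mu>" if "eigenvalue (nb_matrix G) x" for x
  proof -
    from that obtain w where w: "\<exists>e\<in>parcs G. w e \<noteq> 0"
      "\<forall>e\<in>parcs G. (\<Sum>f\<in>parcs G. if nb_adj e f then w f else 0) = x * w e"
      unfolding eigenvalue_nb_matrix_iff[OF fin] by blast
    define M where "M = Max ((\<lambda>e. \<bar>w e\<bar> / v e) ` parcs G)"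
    have le: "\<bar>w f\<bar> \<le> M * v f" if "f \<in> parcs G" for f
    proof -
      have "\<bar>w f\<bar> / v f \<le> M" unfolding M_def using fin that by simp
      with pos[OF that] show ?thesis by (simp add: field_simps)
    qed
    have "M \<in> (\<lambda>e. \<bar>w e\<bar> / v e) ` parcs G"
      unfolding M_def using fin ne by (intro Max_in) auto
    then obtain e where e: "e \<in> parcs G" "M = \<bar>w e\<bar> / v e" by blast
    from w(1) obtain e' where e': "e' \<in> parcs G" "w e' \<noteq> 0" by blast
    have "0 < M * v e'" using le[OF e'(1)] e'(2) by linarith
    then have "M > 0" using pos[OF e'(1)] by (simp add: zero_less_mult_iff)
    have we: "\<bar>w e\<bar> = M * v e" using e pos[OF e(1)] by simp
    have "x * \<bar>w e\<bar> \<le> \<bar>x * w e\<bar>" by (simp add: abs_mult mult_right_mono)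
    also have "\<dots> = \<bar>\<Sum>f\<in>parcs G. if nb_adj e f then w f else 0\<bar>" using w(2) e(1) by simp
    also have "\<dots> \<le> (\<Sum>f\<in>parcs G. if nb_adj e f then M * v f else 0)"
      by (rule order.trans[OF sum_abs sum_mono]) (use le in auto)
    also have "\<dots> = M * (\<Sum>f\<in>parcs G. if nb_adj e f then v f else 0)"
      unfolding sum_distrib_left by (rule sum.cong) auto
    also have "\<dots> = \<mu> * \<bar>w e\<bar>" using eig[OF e(1)] we by simp
    finally show ?thesis using we \<open>M > 0\<close> pos[OF e(1)] by (simp add: mult_le_cancel_right)
  qed
  ultimately show ?thesis unfolding leading_eigenvalue_def by (intro Max_eqI) auto
qed

text \<open>
  This is the Ihara--Bass reduction from arcs to vertices. Write \<open>F b\<close> for a multiple of the sum of an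
  eigenvector \<open>v\<close> over the arcs leaving \<open>b\<close>. The eigenvalue equation says that
  \<open>\<mu> v (a, b) + v (b, a)\<close> equals the sum at \<open>b\<close>; together with the same equation for the reversed arc it
  gives \<open>v (a, b)\<close> as a multiple of \<open>\<mu> F b - F a\<close>. Summing this over the arcs leaving a vertex
  yields the equation for \<open>F\<close> assumed here.
\<close>

lemma leading_eigenvalue_ihara_bass:
  fixes F :: "'a \<Rightarrow> real"
  assumes G: "pair_graph G" and ne: "parcs G \<noteq> {}" and gt1: "\<mu> > 1"
    and pos: "\<And>a b. (a, b) \<in> parcs G \<Longrightarrow> F a < \<mu> * F b"
    and harm: "\<And>b. b \<in> pverts G \<Longrightarrow>
      \<mu> * (\<Sum>c\<in>parcs G `` {b}. F c) = (\<mu>\<^sup>2 - 1 + card (parcs G `` {b})) * F b"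
  shows "leading_eigenvalue (nb_matrix G) = \<mu>"
proof (rule leading_eigenvalue_eqI)
  interpret pair_graph G by fact
  show fin: "finite (parcs G)" by (rule pair_finite_arcs)
  show "parcs G \<noteq> {}" by fact
  define v where "v e = \<mu> * F (snd e) - F (fst e)" for e
  show "v e > 0" if "e \<in> parcs G" for e
    using pos[of "fst e" "snd e"] that by (simp add: v_def)
  show "(\<Sum>f\<in>parcs G. if nb_adj e f then v f else 0) = \<mu> * v e" if e: "e \<in> parcs G" for e
  proof -
    obtain a b where ab: "e = (a, b)" by fastforce
    define N where "N = parcs G `` {b}"
    have b: "b \<in> pverts G" using e ab by (simp add: in_arcsD2)
    have a: "a \<in> N" using e ab by (auto simp: N_def intro: arcs_symmetric)
    have finN: "finite N" unfolding N_def using fin by (rule finite_Image)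
    have "(\<Sum>f\<in>parcs G. if nb_adj e f then v f else 0) = (\<Sum>f\<in>{f \<in> parcs G. nb_adj e f}. v f)"
      using fin by (simp add: sum.inter_filter)
    also have "{f \<in> parcs G. nb_adj e f} = Pair b ` (N - {a})"
      by (auto simp: nb_adj_def ab N_def)
    also have "(\<Sum>f\<in>Pair b ` (N - {a}). v f) = (\<Sum>c\<in>N - {a}. v (b, c))"
      by (subst sum.reindex) (auto simp: inj_on_def)
    also have "\<dots> = (\<Sum>c\<in>N. v (b, c)) - v (b, a)"
      using a finN by (simp add: sum_diff1)
    also have "(\<Sum>c\<in>N. v (b, c)) = \<mu> * (\<Sum>c\<in>N. F c) - card N * F b"
      by (simp add: v_def sum_subtractf sum_distrib_left)
    also have "\<dots> = (\<mu>\<^sup>2 - 1) * F b"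
      using harm[OF b] by (simp add: N_def algebra_simps)
    finally show ?thesis by (simp add: v_def ab algebra_simps power2_eq_square)
  qed
qed

section \<open>Layered graphs\<close>

unbundle bit_operations_syntax

text \<open>
  Inside a layer the graph is the Cayley graph of the group of \<open>k\<close>-bit numbers under \<open>XOR\<close> with connection
  set \<open>{1..j i}\<close>. All elements of this group are involutions, so any set without \<open>0\<close> is an admissible
  connection set, and degrees of either parity occur on one common vertex set.
\<close>

definition layer_nbrs :: "nat \<Rightarrow> (nat \<Rightarrow> nat) \<Rightarrow> nat \<times> nat \<Rightarrow> (nat \<times> nat) set" where
  "layer_nbrs n j = (\<lambda>(i, x). (\<lambda>d. (i, x XOR d)) ` {1..j i} \<union>
     (if i > 0 then {(i - 1, x)} else {}) \<union> (if i < n then {(i + 1, x)} else {}))"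

definition layered_graph :: "nat \<Rightarrow> nat \<Rightarrow> (nat \<Rightarrow> nat) \<Rightarrow> nat pair_pre_digraph" where
  "layered_graph k n j = \<lparr>pverts = prod_encode ` ({..n} \<times> {..<2 ^ k}),
     parcs = {(prod_encode p, prod_encode q) |p q.
       p \<in> {..n} \<times> {..<2 ^ k} \<and> q \<in> layer_nbrs n j p}\<rparr>"

lemma xor_less_power_of_two:
  fixes x d :: nat
  assumes "x < 2 ^ k" "d < 2 ^ k"
  shows "x XOR d < 2 ^ k"
proof -
  have "take_bit k (x XOR d) = x XOR d"
    using assms by (simp add: take_bit_nat_eq_self)
  then show ?thesis by (metis take_bit_nat_less_exp)
qed

lemma xor_left_cancel_nat: "x XOR d = x XOR e \<longleftrightarrow> d = e" for x d e :: nat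
  by (metis xor.assoc xor_self_eq xor.left_neutral)

lemma mem_layer_nbrs:
  "(i', x') \<in> layer_nbrs n j (i, x) \<longleftrightarrow>
    i' = i \<and> (\<exists>d\<in>{1..j i}. x' = x XOR d) \<or> x' = x \<and> (i = Suc i' \<or> i < n \<and> i' = Suc i)"
  by (auto simp: layer_nbrs_def)

lemma layer_nbrs_sym:
  assumes "q \<in> layer_nbrs n j p" "fst p \<le> n"
  shows "p \<in> layer_nbrs n j q"
proof -
  obtain i x i' x' where pq: "p = (i, x)" "q = (i', x')" by fastforce
  have "x = (x XOR d) XOR d" for d :: nat by (simp add: xor.assoc)
  with assms show ?thesis unfolding pq mem_layer_nbrs fst_conv by auto
qed

lemma layer_nbrs_irrefl: "p \<notin> layer_nbrs n j p"
proof -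
  obtain i x where p: "p = (i, x)" by fastforce
  have "x \<noteq> x XOR d" if "d \<in> {1..j i}" for d
    using xor_left_cancel_nat[of x 0 d] that by simp
  then show ?thesis by (simp add: p mem_layer_nbrs)
qed

lemma layer_nbrs_closed:
  assumes "q \<in> layer_nbrs n j p" "p \<in> {..n} \<times> {..<2 ^ k}" "\<And>i. i \<le> n \<Longrightarrow> j i < 2 ^ k"
  shows "q \<in> {..n} \<times> {..<2 ^ k}"
proof -
  obtain i x i' x' where pq: "p = (i, x)" "q = (i', x')" by fastforce
  have i: "i \<le> n" "x < 2 ^ k" using assms(2) by (simp_all add: pq)
  have "x XOR d < 2 ^ k" if "d \<in> {1..j i}" for d
    using i assms(3)[of i] that by (intro xor_less_power_of_two) auto
  with assms(1) i show ?thesis unfolding pq mem_layer_nbrs by auto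
qed

lemma sum_layer_nbrs:
  fixes g :: "nat \<Rightarrow> real"
  shows "(\<Sum>q\<in>layer_nbrs n j (i, x). g (fst q)) =
    j i * g i + (if i > 0 then g (i - 1) else 0) + (if i < n then g (i + 1) else 0)"
proof -
  define A where "A = (\<lambda>d. (i, x XOR d)) ` {1..j i}"
  define L where "L = (if i > 0 then {(i - 1, x)} else {})"
  define R where "R = (if i < n then {(i + 1, x)} else {})"
  have nbrs: "layer_nbrs n j (i, x) = (A \<union> L) \<union> R"
    by (simp add: layer_nbrs_def A_def L_def R_def)
  have fin: "finite A" "finite L" "finite R" by (simp_all add: A_def L_def R_def)
  have disj: "A \<inter> L = {}" "(A \<union> L) \<inter> R = {}" by (auto simp: A_def L_def R_def split: if_splits)
  have "(\<Sum>q\<in>A. g (fst q)) = j i * g i"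
    unfolding A_def by (subst sum.reindex) (simp_all add: inj_on_def xor_left_cancel_nat)
  then show ?thesis
    using fin disj by (simp add: nbrs sum.union_disjoint) (simp add: L_def R_def)
qed

lemma pair_graph_layered_graph:
  assumes "\<And>i. i \<le> n \<Longrightarrow> j i < 2 ^ k"
  shows "pair_graph (layered_graph k n j)"
proof
  let ?G = "layered_graph k n j" and ?V = "{..n} \<times> {..<2 ^ k} :: (nat \<times> nat) set"
  have arcs: "(a, b) \<in> parcs ?G \<longleftrightarrow>
      (\<exists>p q. a = prod_encode p \<and> b = prod_encode q \<and> p \<in> ?V \<and> q \<in> layer_nbrs n j p)" for a b
    by (simp add: layered_graph_def)
  have cl: "q \<in> ?V" if "q \<in> layer_nbrs n j p" "p \<in> ?V" for p q
    using that assms by (rule layer_nbrs_closed)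
  have arc: "\<exists>p q. a = prod_encode p \<and> b = prod_encode q \<and> p \<in> ?V \<and> q \<in> ?V \<and> q \<in> layer_nbrs n j p"
    if "(a, b) \<in> parcs ?G" for a b
    using that cl unfolding arcs by blast
  have V: "pverts ?G = prod_encode ` ?V" by (simp add: layered_graph_def)
  show "fst e \<in> pverts ?G" "snd e \<in> pverts ?G" "fst e \<noteq> snd e" if e: "e \<in> parcs ?G" for e
  proof -
    obtain p q where "fst e = prod_encode p" "snd e = prod_encode q" "p \<in> ?V" "q \<in> ?V"
      "q \<in> layer_nbrs n j p"
      using arc[of "fst e" "snd e"] e unfolding prod.collapse by blast
    moreover from this have "p \<noteq> q" using layer_nbrs_irrefl by blast
    ultimately show "fst e \<in> pverts ?G" "snd e \<in> pverts ?G" "fst e \<noteq> snd e"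
      unfolding V by (simp_all only: imageI prod_encode_eq not_False_eq_True)
  qed
  then have "parcs ?G \<subseteq> pverts ?G \<times> pverts ?G" unfolding subset_iff mem_Times_iff by blast
  moreover show "finite (pverts ?G)" by (simp add: V)
  ultimately show "finite (parcs ?G)" by (meson finite_SigmaI finite_subset)
  have "(b, a) \<in> parcs ?G" if ab: "(a, b) \<in> parcs ?G" for a b
  proof -
    obtain p q where pq: "a = prod_encode p" "b = prod_encode q" "p \<in> ?V" "q \<in> ?V"
      "q \<in> layer_nbrs n j p"
      using arc[OF ab] by blast
    from pq(3) have "fst p \<le> n" by (simp add: mem_Times_iff)
    with pq(5) have "p \<in> layer_nbrs n j q" by (rule layer_nbrs_sym)
    with pq show ?thesis unfolding arcs by blast
  qed
  then have "sym (parcs ?G)" by (rule symI)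
  then show "symmetric (with_proj ?G)" by (simp add: symmetric_def)
qed

lemma layered_graph_Image:
  assumes "p \<in> {..n} \<times> {..<2 ^ k}"
  shows "parcs (layered_graph k n j) `` {prod_encode p} = prod_encode ` layer_nbrs n j p"
proof -
  have "b \<in> parcs (layered_graph k n j) `` {prod_encode p} \<longleftrightarrow>
      (\<exists>q. b = prod_encode q \<and> q \<in> layer_nbrs n j p)" for b
    using assms by (simp add: layered_graph_def prod_encode_eq) blast
  then show ?thesis by blast
qed

lemma card_layer_nbrs:
  "card (layer_nbrs n j (i, x)) = j i + (if i > 0 then 1 else 0) + (if i < n then 1 else 0)"
proof -
  have "real (card (layer_nbrs n j (i, x))) =
    real (j i + (if i > 0 then 1 else 0) + (if i < n then 1 else 0))"
    using sum_layer_nbrs[of "\<lambda>_. 1" n j i x] by simp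
  then show ?thesis by (simp only: of_nat_eq_iff)
qed

lemma out_degree_layered_graph:
  assumes "p \<in> {..n} \<times> {..<2 ^ k}"
  shows "out_degree (with_proj (layered_graph k n j)) (prod_encode p) = card (layer_nbrs n j p)"
proof -
  have "out_arcs (with_proj (layered_graph k n j)) (prod_encode p) =
      Pair (prod_encode p) ` (prod_encode ` layer_nbrs n j p)"
    unfolding layered_graph_Image[OF assms, symmetric] by (auto simp: out_arcs_def)
  then show ?thesis
    by (simp add: out_degree_def card_image inj_on_def)
qed

text \<open>
  For a function that depends only on the layer, the vertex equation becomes a three-term recurrence.
  On arcs inside a layer the positivity condition is just \<open>\<mu> > 1\<close>.
\<close>

lemma leading_eigenvalue_layered_graph:
  fixes f :: "nat \<Rightarrow> real"
  assumes j: "\<And>i. i \<le> n \<Longrightarrow> j i < 2 ^ k" and ne: "j 0 > 0" and gt1: "\<mu> > 1"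
    and fpos: "\<And>i. i \<le> n \<Longrightarrow> f i > 0"
    and up: "\<And>i. i < n \<Longrightarrow> f i < \<mu> * f (Suc i)"
    and down: "\<And>i. i < n \<Longrightarrow> f (Suc i) < \<mu> * f i"
    and harm: "\<And>i. i \<le> n \<Longrightarrow>
      \<mu> * (j i * f i + (if i > 0 then f (i - 1) else 0) + (if i < n then f (i + 1) else 0)) =
      (\<mu>\<^sup>2 - 1 + j i + (if i > 0 then 1 else 0) + (if i < n then 1 else 0)) * f i"
  shows "leading_eigenvalue (nb_matrix (layered_graph k n j)) = \<mu>"
proof (rule leading_eigenvalue_ihara_bass)
  let ?G = "layered_graph k n j" and ?V = "{..n} \<times> {..<2 ^ k} :: (nat \<times> nat) set"
  define F where "F a = f (fst (prod_decode a))" for a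
  show "pair_graph ?G" using j by (rule pair_graph_layered_graph)
  have "(0, 0 XOR 1) \<in> layer_nbrs n j (0, 0)" using ne by (auto simp: layer_nbrs_def)
  moreover have "(0, 0) \<in> ?V" by simp
  ultimately show "parcs ?G \<noteq> {}" unfolding layered_graph_def by fastforce
  show "\<mu> > 1" by fact
  show "F a < \<mu> * F b" if "(a, b) \<in> parcs ?G" for a b
  proof -
    from that obtain i x q where *: "a = prod_encode (i, x)" "b = prod_encode q" "i \<le> n"
      "q \<in> layer_nbrs n j (i, x)" by (auto simp: layered_graph_def)
    from *(4) consider "fst q = i" | "i > 0" "fst q = i - 1" | "i < n" "fst q = i + 1"
      by (auto simp: layer_nbrs_def split: if_splits)
    then show ?thesis
    proof cases
      case 1 then show ?thesis using * fpos[of i] gt1 by (simp add: F_def)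
    next
      case 2 then show ?thesis using * down[of "i - 1"] by (simp add: F_def)
    next
      case 3 then show ?thesis using * up[of i] by (simp add: F_def)
    qed
  qed
  show "\<mu> * (\<Sum>c\<in>parcs ?G `` {b}. F c) = (\<mu>\<^sup>2 - 1 + card (parcs ?G `` {b})) * F b"
    if "b \<in> pverts ?G" for b
  proof -
    from that obtain i x where b: "b = prod_encode (i, x)" "(i, x) \<in> ?V"
      by (auto simp: layered_graph_def)
    have "(\<Sum>c\<in>parcs ?G `` {b}. F c) = (\<Sum>q\<in>layer_nbrs n j (i, x). f (fst q))"
      unfolding b(1) layered_graph_Image[OF b(2)]
      by (subst sum.reindex) (auto simp: F_def inj_on_def)
    moreover have "card (parcs ?G `` {b}) = card (layer_nbrs n j (i, x))"
      unfolding b(1) layered_graph_Image[OF b(2)] by (simp add: card_image inj_on_def)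
    moreover have "F b = f i" by (simp add: F_def b)
    ultimately show ?thesis
      using harm[of i] b(2) by (simp add: sum_layer_nbrs card_layer_nbrs add_ac)
  qed
qed

section \<open>The digit recursion for the forward shares\<close>

text \<open>
  If the arc to the next layer has the share \<open>x\<close> of the total value of the arcs leaving its tail, then
  \<open>carry \<mu> x\<close> is the share, among the arcs leaving its head, of those that do not return.
\<close>

definition carry :: "real \<Rightarrow> real \<Rightarrow> real" where
  "carry \<mu> x = \<mu>\<^sup>2 * x / (1 + (\<mu>\<^sup>2 - 1) * x)"

primrec remainder :: "(nat \<Rightarrow> nat) \<Rightarrow> real \<Rightarrow> nat \<Rightarrow> real" where
  "remainder j \<mu> 0 = 1 - j 0 / (\<mu> + 1)"
| "remainder j \<mu> (Suc i) = carry \<mu> (remainder j \<mu> i) - j (Suc i) / (\<mu> + 1)"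

lemma carry_denom_pos: "1 + (\<mu>\<^sup>2 - 1) * x > 0" if "\<mu> > 1" "x \<ge> 0" for \<mu> x :: real
proof -
  have "\<mu>\<^sup>2 > 1" using that by (simp add: one_less_power)
  then show ?thesis using that by (simp add: add_pos_nonneg)
qed

lemma carry_nonneg: "\<mu> > 1 \<Longrightarrow> x \<ge> 0 \<Longrightarrow> carry \<mu> x \<ge> 0"
  using carry_denom_pos[of \<mu> x] by (simp add: carry_def)

lemma carry_pos: "\<mu> > 1 \<Longrightarrow> x > 0 \<Longrightarrow> carry \<mu> x > 0"
  using carry_denom_pos[of \<mu> x] by (simp add: carry_def)

lemma carry_diff:
  assumes "\<mu> > 1" "a \<ge> 0" "b \<ge> 0"
  shows "carry \<mu> a - carry \<mu> b =
    \<mu>\<^sup>2 * (a - b) / ((1 + (\<mu>\<^sup>2 - 1) * a) * (1 + (\<mu>\<^sup>2 - 1) * b))"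
  using carry_denom_pos[of \<mu> a] carry_denom_pos[of \<mu> b] assms
  by (simp add: carry_def diff_frac_eq) (simp add: algebra_simps)

lemma carry_strict_mono: "carry \<mu> a < carry \<mu> b" if "\<mu> > 1" "0 \<le> a" "a < b"
proof -
  have "carry \<mu> b - carry \<mu> a > 0"
    using that carry_denom_pos[of \<mu> a] carry_denom_pos[of \<mu> b] by (simp add: carry_diff)
  then show ?thesis by simp
qed

lemma carry_mono_base: "carry \<beta> x \<le> carry \<mu> x" if "1 < \<beta>" "\<beta> \<le> \<mu>" "0 \<le> x" "x \<le> 1"
proof -
  have "\<beta>\<^sup>2 \<le> \<mu>\<^sup>2" using that by (intro power_mono) auto
  then have "\<beta>\<^sup>2 * (x * (1 - x)) \<le> \<mu>\<^sup>2 * (x * (1 - x))"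
    using that by (intro mult_right_mono) auto
  then show ?thesis
    using that carry_denom_pos[of \<beta> x] carry_denom_pos[of \<mu> x]
    by (simp add: carry_def divide_le_eq frac_le_eq field_simps)
qed

lemma carry_1: "\<mu> > 1 \<Longrightarrow> carry \<mu> 1 = 1"
  by (simp add: carry_def)

text \<open>
  The greedy remainders stay below \<open>1 / (\<mu> + 1)\<close>, so after the first step at most \<open>\<mu>\<close> units
  of \<open>1 / (\<mu> + 1)\<close> are available. This makes room for the two arcs to the adjacent layers in the degree.
\<close>

lemma carry_digit: "carry \<mu> (1 / (\<mu> + 1)) = \<mu> / (\<mu> + 1)" if "\<mu> > 1"
proof -
  have "1 + (\<mu>\<^sup>2 - 1) * (1 / (\<mu> + 1)) = \<mu>"
    using that by (simp add: field_simps power2_eq_square)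
  then show ?thesis
    using that by (simp add: carry_def power2_eq_square)
qed

lemma remainder_less_1:
  assumes "\<mu> > 1" "j 0 > 0" "\<And>i. i < n \<Longrightarrow> remainder j \<mu> i > 0"
  shows "remainder j \<mu> n < 1"
  using assms(3)
proof (induction n)
  case 0 then show ?case using assms(1,2) by simp
next
  case (Suc n)
  have "carry \<mu> (remainder j \<mu> n) < carry \<mu> 1"
    using Suc.IH Suc.prems assms(1) by (intro carry_strict_mono) (auto simp: less_imp_le)
  moreover have "j (Suc n) / (\<mu> + 1) \<ge> 0" using assms(1) by simp
  ultimately show ?case unfolding remainder.simps carry_1[OF assms(1)] by linarith
qed

text \<open>
  Increasing the base makes each digit cheaper and each carry larger. The comparison uses that \<open>carry\<close> is
  monotone in the base on \<open>[0, 1]\<close>, which is why positivity at the smaller base is needed.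
\<close>

lemma remainder_mono_base:
  assumes "1 < \<beta>" "\<beta> \<le> \<mu>" "j 0 > 0" "\<And>i. i < n \<Longrightarrow> remainder j \<beta> i > 0"
  shows "remainder j \<beta> n \<le> remainder j \<mu> n"
  using assms(4)
proof (induction n)
  case 0 then show ?case using assms(1,2) by (simp add: divide_left_mono)
next
  case (Suc n)
  have pos: "remainder j \<beta> n > 0" using Suc.prems by simp
  have le1: "remainder j \<beta> n < 1"
    using assms Suc.prems by (intro remainder_less_1) auto
  have le: "remainder j \<beta> n \<le> remainder j \<mu> n" using Suc by simp
  have "carry \<beta> (remainder j \<beta> n) \<le> carry \<mu> (remainder j \<beta> n)"
    using assms pos le1 by (intro carry_mono_base) auto
  also have "\<dots> \<le> carry \<mu> (remainder j \<mu> n)"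
    using carry_strict_mono[of \<mu> "remainder j \<beta> n" "remainder j \<mu> n"] assms pos le
    by (cases "remainder j \<beta> n = remainder j \<mu> n") auto
  finally show ?case
    using assms(1,2) divide_left_mono[of "\<beta> + 1" "\<mu> + 1" "real (j (Suc n))"] by simp
qed

text \<open>
  Each digit is the largest that leaves a nonnegative remainder.
\<close>

lemma ex_greedy_digits:
  assumes "\<alpha> > 1"
  obtains j where "j 0 = nat \<lfloor>\<alpha> + 1\<rfloor>" "\<And>i. i > 0 \<Longrightarrow> real (j i) \<le> \<alpha>"
    "\<And>i. 0 \<le> remainder j \<alpha> i" "\<And>i. remainder j \<alpha> i < 1 / (\<alpha> + 1)"
proof -
  \<comment> \<open>\<open>z i\<close> is what remains before the \<open>i\<close>-th digit is subtracted.\<close>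
  define z where "z = rec_nat 1 (\<lambda>_ z. carry \<alpha> (z - nat \<lfloor>z * (\<alpha> + 1)\<rfloor> / (\<alpha> + 1)))"
  define j where "j i = nat \<lfloor>z i * (\<alpha> + 1)\<rfloor>" for i
  have z0: "z 0 = 1" and zS: "z (Suc i) = carry \<alpha> (z i - j i / (\<alpha> + 1))" for i
    by (simp_all add: z_def j_def)
  have rem: "remainder j \<alpha> i = z i - j i / (\<alpha> + 1)" for i
    by (induction i) (simp_all add: z0 zS)
  have step: "0 \<le> z i - j i / (\<alpha> + 1)" "z i - j i / (\<alpha> + 1) < 1 / (\<alpha> + 1)"
    if "z i \<ge> 0" for i
  proof -
    have "real (j i) = of_int \<lfloor>z i * (\<alpha> + 1)\<rfloor>" using that assms by (simp add: j_def)
    then have "real (j i) \<le> z i * (\<alpha> + 1)" "z i * (\<alpha> + 1) < real (j i) + 1" by linarith+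
    moreover have "\<alpha> + 1 > 0" using assms by simp
    ultimately have "j i / (\<alpha> + 1) \<le> z i" "z i < (real (j i) + 1) / (\<alpha> + 1)"
      using pos_divide_le_eq[of "\<alpha> + 1" "j i" "z i"] pos_less_divide_eq[of "\<alpha> + 1" "z i" "real (j i) + 1"]
      by blast+
    then show "0 \<le> z i - j i / (\<alpha> + 1)" "z i - j i / (\<alpha> + 1) < 1 / (\<alpha> + 1)"
      unfolding add_divide_distrib by linarith+
  qed
  have nonneg: "z i \<ge> 0" for i
  proof (induction i)
    case 0 show ?case by (simp add: z0)
  next
    case (Suc i)
    show ?case unfolding zS using assms step(1)[OF Suc] by (rule carry_nonneg)
  qed
  have le: "real (j i) \<le> \<alpha>" if i0: "i > 0" for i
  proof -
    obtain i' where i: "i = Suc i'" using i0 gr0_implies_Suc by blast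
    have "carry \<alpha> (z i' - j i' / (\<alpha> + 1)) < carry \<alpha> (1 / (\<alpha> + 1))"
      by (rule carry_strict_mono[OF assms step[OF nonneg]])
    then have "z (Suc i') < \<alpha> / (\<alpha> + 1)"
      unfolding zS carry_digit[OF assms] .
    with step(1)[OF nonneg, of i] have "j i / (\<alpha> + 1) \<le> \<alpha> / (\<alpha> + 1)"
      unfolding i by linarith
    moreover have "\<alpha> + 1 > 0" using assms by simp
    ultimately show ?thesis by (meson divide_le_cancel not_less_iff_gr_or_eq)
  qed
  show ?thesis
  proof (rule that[of j])
    show "j 0 = nat \<lfloor>\<alpha> + 1\<rfloor>" by (simp add: j_def z0)
    show "0 \<le> remainder j \<alpha> i" "remainder j \<alpha> i < 1 / (\<alpha> + 1)" for i
      unfolding rem by (fact step[OF nonneg])+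
  qed (fact le)
qed

text \<open>
  The derivative of \<open>carry \<alpha>\<close> at \<open>x\<close> is \<open>(\<alpha> / (1 + (\<alpha>\<^sup>2 - 1) x))\<^sup>2\<close>, which is at least \<open>1\<close> for
  \<open>x \<le> 1 / (\<alpha> + 1)\<close>, with equality only at the right end. The remainders for \<open>\<beta>\<close> lie below those for \<open>\<alpha>\<close>
  by at least the initial difference, so secants between the two have a slope bounded
  away from \<open>1\<close>. Hence the differences grow geometrically as long as the remainders for \<open>\<beta>\<close> are
  positive, whereas they are smaller than \<open>1 / (\<alpha> + 1)\<close>.
\<close>

lemma remainder_reaches_zero:
  assumes "1 < \<beta>" "\<beta> < \<alpha>" "j 0 > 0"
    and small: "\<And>i. 0 \<le> remainder j \<alpha> i" "\<And>i. remainder j \<alpha> i < 1 / (\<alpha> + 1)"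
  shows "\<exists>n. remainder j \<beta> n \<le> 0"
proof (rule ccontr)
  assume "\<not> (\<exists>n. remainder j \<beta> n \<le> 0)"
  then have pos: "remainder j \<beta> i > 0" for i by (simp add: not_le)
  define \<Delta> where "\<Delta> i = remainder j \<alpha> i - remainder j \<beta> i" for i
  \<comment> \<open>The growth factor: below \<open>1 / (\<alpha> + 1)\<close>, secants of \<open>carry \<alpha>\<close> of length at least
    \<open>\<Delta> 0\<close> have at least this slope.\<close>
  define c where "c = 1 + (\<alpha>\<^sup>2 - 1) * \<Delta> 0 / \<alpha>"
  have \<alpha>: "\<alpha> > 1" "\<alpha>\<^sup>2 > 1" using assms by (simp_all add: one_less_power)
  have 0: "\<Delta> 0 > 0"
    using assms by (simp add: \<Delta>_def divide_strict_left_mono)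
  have "c > 1" using 0 \<alpha> by (simp add: c_def)
  have step: "\<Delta> (Suc i) \<ge> c * \<Delta> i" if ge: "\<Delta> i \<ge> \<Delta> 0" for i
  proof -
    define a b where "a = remainder j \<alpha> i" and "b = remainder j \<beta> i"
    have b: "0 < b" "b < 1"
      using pos remainder_less_1[of \<beta> j i] assms by (auto simp: b_def)
    have a: "0 \<le> a" "a < 1 / (\<alpha> + 1)" using small by (auto simp: a_def)
    have d: "a - b = \<Delta> i" by (simp add: a_def b_def \<Delta>_def)
    define A B where "A = 1 + (\<alpha>\<^sup>2 - 1) * a" and "B = 1 + (\<alpha>\<^sup>2 - 1) * b"
    have "(\<alpha>\<^sup>2 - 1) * a \<le> (\<alpha>\<^sup>2 - 1) * (1 / (\<alpha> + 1))"
      using a \<alpha> by (intro mult_left_mono) auto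
    also have "\<dots> = \<alpha> - 1" using \<alpha> by (simp add: field_simps power2_eq_square)
    finally have A: "A \<le> \<alpha>" by (simp add: A_def)
    have A0: "A > 0" and B0: "B > 0"
      unfolding A_def B_def using a b \<alpha> by (auto intro!: carry_denom_pos)
    have "B = A - (\<alpha>\<^sup>2 - 1) * \<Delta> i" by (simp add: A_def B_def d[symmetric] algebra_simps)
    moreover have "(\<alpha>\<^sup>2 - 1) * \<Delta> 0 \<le> (\<alpha>\<^sup>2 - 1) * \<Delta> i" using ge \<alpha> by (intro mult_left_mono) auto
    ultimately have B: "B \<le> \<alpha> - (\<alpha>\<^sup>2 - 1) * \<Delta> 0" using A by linarith
    have "c * B \<le> c * (\<alpha> - (\<alpha>\<^sup>2 - 1) * \<Delta> 0)"
      using B \<open>c > 1\<close> by (intro mult_left_mono) auto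
    also have "\<dots> = \<alpha> - ((\<alpha>\<^sup>2 - 1) * \<Delta> 0)\<^sup>2 / \<alpha>"
      using \<alpha> by (simp add: c_def field_simps power2_eq_square)
    also have "\<dots> \<le> \<alpha>" using \<alpha> by simp
    finally have cB: "c * B \<le> \<alpha>" .
    have "c * (A * B) = A * (c * B)" by simp
    also have "\<dots> \<le> \<alpha> * \<alpha>" using A cB A0 B0 \<open>c > 1\<close> \<alpha> by (intro mult_mono) auto
    finally have "c * (A * B) \<le> \<alpha>\<^sup>2" by (simp add: power2_eq_square)
    then have "c \<le> \<alpha>\<^sup>2 / (A * B)" using A0 B0 by (simp add: field_simps)
    then have "c * \<Delta> i \<le> \<alpha>\<^sup>2 / (A * B) * \<Delta> i"
      using ge 0 by (intro mult_right_mono) auto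
    also have "\<dots> = carry \<alpha> a - carry \<alpha> b"
      using a b \<alpha> by (simp add: carry_diff A_def B_def d)
    also have "\<dots> \<le> carry \<alpha> a - carry \<beta> b"
      using carry_mono_base[of \<beta> \<alpha> b] assms b by simp
    also have "\<dots> \<le> \<Delta> (Suc i)"
      using assms(1,2) divide_left_mono[of "\<beta> + 1" "\<alpha> + 1" "real (j (Suc i))"]
      by (simp add: \<Delta>_def a_def b_def)
    finally show ?thesis .
  qed
  have grow: "\<Delta> i \<ge> c ^ i * \<Delta> 0" for i
  proof (induction i)
    case (Suc i)
    have "1 \<le> c ^ i" using \<open>c > 1\<close> by simp
    then have "\<Delta> i \<ge> \<Delta> 0" using Suc 0 mult_right_mono[of 1 "c ^ i" "\<Delta> 0"] by linarith
    then have "c * \<Delta> i \<le> \<Delta> (Suc i)" by (rule step)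
    moreover have "c * (c ^ i * \<Delta> 0) \<le> c * \<Delta> i"
      using Suc \<open>c > 1\<close> by (intro mult_left_mono) auto
    ultimately show ?case unfolding power_Suc mult.assoc by linarith
  qed simp
  obtain n where "1 / \<Delta> 0 < c ^ n" using real_arch_pow[OF \<open>c > 1\<close>] by blast
  then have "1 < c ^ n * \<Delta> 0" using 0 by (simp add: field_simps)
  also have "\<dots> \<le> \<Delta> n" by (rule grow)
  also have "\<dots> < 1 / (\<alpha> + 1)" using small(2)[of n] pos[of n] by (simp add: \<Delta>_def)
  also have "\<dots> < 1" using \<alpha> by simp
  finally have "(1::real) < 1" .
  then show False by simp
qed

lemma continuous_on_remainder:
  assumes "1 < \<beta>" "j 0 > 0" "\<And>i. i < n \<Longrightarrow> remainder j \<beta> i > 0"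
  shows "continuous_on {\<beta>..\<alpha>} (\<lambda>\<mu>. remainder j \<mu> n)"
  using assms(3)
proof (induction n)
  case 0 then show ?case using assms(1) by (auto intro!: continuous_intros)
next
  case (Suc n)
  have "1 + (\<mu>\<^sup>2 - 1) * remainder j \<mu> n \<noteq> 0" if "\<mu> \<in> {\<beta>..\<alpha>}" for \<mu>
  proof -
    have "remainder j \<beta> n \<le> remainder j \<mu> n"
      using Suc.prems assms that by (intro remainder_mono_base) auto
    moreover have "remainder j \<beta> n > 0" using Suc.prems by simp
    ultimately show ?thesis
      using carry_denom_pos[of \<mu> "remainder j \<mu> n"] that assms(1) by auto
  qed
  moreover have "continuous_on {\<beta>..\<alpha>} (\<lambda>\<mu>. remainder j \<mu> n)" using Suc by simp
  ultimately show ?case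
    using assms(1) by (auto simp: carry_def intro!: continuous_intros)
qed

text \<open>
  Cutting at the first index where the remainder for \<open>\<beta>\<close> fails to be positive keeps the earlier
  remainders positive, hence continuous in the base, on all of \<open>[\<beta>, \<alpha>]\<close>.
\<close>

lemma ex_terminating_base:
  assumes "1 < \<beta>" "\<beta> < \<alpha>" "j 0 > 0"
    and small: "\<And>i. 0 \<le> remainder j \<alpha> i" "\<And>i. remainder j \<alpha> i < 1 / (\<alpha> + 1)"
  obtains \<mu> n where "\<beta> \<le> \<mu>" "\<mu> \<le> \<alpha>" "remainder j \<mu> n = 0"
    "\<And>i. i < n \<Longrightarrow> 0 < remainder j \<mu> i"
proof -
  define n where "n = (LEAST n. remainder j \<beta> n \<le> 0)"
  have n: "remainder j \<beta> n \<le> 0"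
    unfolding n_def using remainder_reaches_zero[OF assms] by (rule LeastI_ex)
  have pos: "remainder j \<beta> i > 0" if "i < n" for i
    using not_less_Least[of i "\<lambda>n. remainder j \<beta> n \<le> 0"] that by (simp add: n_def not_le)
  have "continuous_on {\<beta>..\<alpha>} (\<lambda>\<mu>. remainder j \<mu> n)"
    using assms(1,3) pos by (rule continuous_on_remainder)
  from IVT'[of "\<lambda>\<mu>. remainder j \<mu> n", OF n small(1) _ this] assms(2)
  obtain \<mu> where \<mu>: "\<beta> \<le> \<mu>" "\<mu> \<le> \<alpha>" "remainder j \<mu> n = 0" by auto
  have "0 < remainder j \<mu> i" if "i < n" for i
  proof -
    have "remainder j \<beta> i \<le> remainder j \<mu> i"
      using assms \<mu> pos that by (intro remainder_mono_base) auto
    with pos[OF that] show ?thesis by linarith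
  qed
  with \<mu> show ?thesis using that by blast
qed

section \<open>From terminating digits to the eigenvalue\<close>

text \<open>
  Up to a constant factor, \<open>layer_fun j \<mu> i\<close> is the total value of the arcs leaving a vertex of layer \<open>i\<close>.
  The step factor is that total at the head of a forward arc in terms of the total at its tail, where
  the forward share is \<open>remainder j \<mu> i\<close>.
\<close>

definition layer_fun :: "(nat \<Rightarrow> nat) \<Rightarrow> real \<Rightarrow> nat \<Rightarrow> real" where
  "layer_fun j \<mu> i = (\<Prod>k<i. (1 + (\<mu>\<^sup>2 - 1) * remainder j \<mu> k) / \<mu>)"

lemma layer_fun_Suc:
  assumes "\<mu> > 1"
  shows "\<mu> * layer_fun j \<mu> (Suc i) = (1 + (\<mu>\<^sup>2 - 1) * remainder j \<mu> i) * layer_fun j \<mu> i"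
  using assms by (simp add: layer_fun_def)

lemma layer_fun_pos:
  assumes "\<mu> > 1" "\<And>i. i < n \<Longrightarrow> 0 < remainder j \<mu> i" "i \<le> n"
  shows "layer_fun j \<mu> i > 0"
  unfolding layer_fun_def
proof (rule prod_pos)
  fix k assume "k \<in> {..<i}"
  then have "0 \<le> remainder j \<mu> k" using assms(2)[of k] assms(3) by simp
  then show "0 < (1 + (\<mu>\<^sup>2 - 1) * remainder j \<mu> k) / \<mu>"
    using carry_denom_pos[OF assms(1)] assms(1) by simp
qed

text \<open>
  The two inequalities express that arcs to the next layer and their reversals have positive
  values: the forward share lies strictly between \<open>0\<close> and \<open>1\<close>.
\<close>

lemma layer_fun_ratio:
  assumes \<mu>: "\<mu> > 1" and j0: "j 0 > 0"
    and pos: "\<And>i. i < n \<Longrightarrow> 0 < remainder j \<mu> i" and i: "i < n"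
  shows "layer_fun j \<mu> i < \<mu> * layer_fun j \<mu> (Suc i)"
    and "layer_fun j \<mu> (Suc i) < \<mu> * layer_fun j \<mu> i"
proof -
  define x f where "x = remainder j \<mu> i" and "f = layer_fun j \<mu> i"
  have f: "f > 0" unfolding f_def using \<mu> pos i by (intro layer_fun_pos[of _ n]) auto
  have x: "0 < x" "x < 1"
    unfolding x_def using \<mu> j0 pos i by (auto intro: remainder_less_1)
  have \<mu>2: "\<mu>\<^sup>2 - 1 > 0" using \<mu> by (simp add: one_less_power)
  have S: "\<mu> * layer_fun j \<mu> (Suc i) = (1 + (\<mu>\<^sup>2 - 1) * x) * f"
    unfolding x_def f_def by (rule layer_fun_Suc[OF \<mu>])
  have "1 * f < (1 + (\<mu>\<^sup>2 - 1) * x) * f"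
    using f x \<mu>2 by (intro mult_strict_right_mono) simp_all
  then show "f < \<mu> * layer_fun j \<mu> (Suc i)" by (simp add: S)
  have "(\<mu>\<^sup>2 - 1) * x < (\<mu>\<^sup>2 - 1) * 1"
    using x(2) \<mu>2 by (rule mult_strict_left_mono)
  then have "(1 + (\<mu>\<^sup>2 - 1) * x) * f < \<mu>\<^sup>2 * f"
    using f by (intro mult_strict_right_mono) simp_all
  then have "\<mu> * layer_fun j \<mu> (Suc i) < \<mu> * (\<mu> * f)"
    by (simp add: S power2_eq_square mult.assoc)
  then show "layer_fun j \<mu> (Suc i) < \<mu> * f"
    using \<mu> by (simp only: mult_less_cancel_left_pos)
qed

text \<open>
  The term of the missing previous layer is absent at layer \<open>0\<close> because the recursion starts with the
  full share \<open>1\<close>; the term of the missing next layer is absent at layer \<open>n\<close> because the last remainder is \<open>0\<close>.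
\<close>

lemma layer_fun_ihara_bass:
  assumes \<mu>: "\<mu> > 1" and zero: "remainder j \<mu> n = 0"
    and pos: "\<And>i. i < n \<Longrightarrow> 0 < remainder j \<mu> i" and i: "i \<le> n"
  defines "f \<equiv> layer_fun j \<mu>"
  shows "\<mu> * (j i * f i + (if i > 0 then f (i - 1) else 0) + (if i < n then f (i + 1) else 0)) =
    (\<mu>\<^sup>2 - 1 + j i + (if i > 0 then 1 else 0) + (if i < n then 1 else 0)) * f i"
proof -
  define D where "D i = 1 + (\<mu>\<^sup>2 - 1) * remainder j \<mu> i" for i
  have D: "D i > 0" if "i < n" for i
    unfolding D_def using \<mu> pos[OF that] by (intro carry_denom_pos) auto
  have fS: "\<mu> * f (Suc i) = D i * f i" for i
    unfolding f_def D_def by (rule layer_fun_Suc[OF \<mu>])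
  have digit: "(\<mu>\<^sup>2 - 1) * (real d / (\<mu> + 1)) = (\<mu> - 1) * d" for d
    using \<mu> by (simp add: field_simps power2_eq_square)
  \<comment> \<open>At the two ends, the general formula for a neighbouring layer would contribute \<open>f i\<close>. The missing
    degree there compensates for it.\<close>
  have right: "\<mu> * (if i < n then f (i + 1) else 0) = D i * f i - (if i < n then 0 else f i)"
    using i zero by (auto simp: fS D_def)
  have left: "\<mu> * (if i > 0 then f (i - 1) else 0) =
      (\<mu>\<^sup>2 + 1 - (\<mu> - 1) * j i - D i) * f i - (if i > 0 then 0 else f i)"
  proof (cases i)
    case 0
    have "D 0 = \<mu>\<^sup>2 - (\<mu> - 1) * j 0"
      using digit[of "j 0"] by (simp add: D_def algebra_simps)
    then show ?thesis by (simp add: 0)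
  next
    case (Suc k)
    have Dk: "D k > 0" using D i Suc by simp
    have "(\<mu>\<^sup>2 - 1) * carry \<mu> (remainder j \<mu> k) = \<mu>\<^sup>2 * (D k - 1) / D k"
      by (simp add: carry_def D_def)
    also have "\<dots> = \<mu>\<^sup>2 - \<mu>\<^sup>2 / D k"
      using Dk by (simp add: field_simps)
    finally have "\<mu>\<^sup>2 + 1 - (\<mu> - 1) * j i - D i = \<mu>\<^sup>2 / D k"
      using digit[of "j i"] by (simp add: D_def Suc right_diff_distrib)
    moreover have "\<mu> * f k = \<mu>\<^sup>2 / D k * f i"
      using fS[of k] Dk Suc by (simp add: field_simps power2_eq_square)
    ultimately show ?thesis by (simp add: Suc)
  qed
  show ?thesis
    unfolding distrib_left left right by (auto simp: algebra_simps)
qed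

lemma leading_eigenvalue_of_remainder:
  assumes "\<And>i. i \<le> n \<Longrightarrow> j i < 2 ^ k" "j 0 > 0" "\<mu> > 1"
    and "remainder j \<mu> n = 0" "\<And>i. i < n \<Longrightarrow> 0 < remainder j \<mu> i"
  shows "leading_eigenvalue (nb_matrix (layered_graph k n j)) = \<mu>"
  using assms
  by (intro leading_eigenvalue_layered_graph[where f = "layer_fun j \<mu>"]
      layer_fun_pos layer_fun_ratio layer_fun_ihara_bass)

theorem theorem2:
  fixes r :: nat and \<alpha> \<epsilon> :: real
  assumes "r > 1" and "1 < \<alpha>" and "\<alpha> < 2 * real r - 1" and "\<epsilon> > 0"
  shows "\<exists>G :: nat pair_pre_digraph. pair_graph G \<and> pverts G \<noteq> {} \<and>
    (\<forall>v\<in>pverts G. out_degree (with_proj G) v \<in> {2..2 * r}) \<and>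
    \<bar>leading_eigenvalue (nb_matrix G) - \<alpha>\<bar> < \<epsilon>"
proof -
  obtain j where j0: "j 0 = nat \<lfloor>\<alpha> + 1\<rfloor>" and jS: "\<And>i. i > 0 \<Longrightarrow> real (j i) \<le> \<alpha>"
    and small: "\<And>i. 0 \<le> remainder j \<alpha> i" "\<And>i. remainder j \<alpha> i < 1 / (\<alpha> + 1)"
    using ex_greedy_digits[OF assms(2)] by metis
  have "2 \<le> \<lfloor>\<alpha> + 1\<rfloor>" using assms(2) by (simp add: le_floor_iff)
  moreover have "\<lfloor>\<alpha> + 1\<rfloor> < 2 * int r"
    unfolding floor_less_iff using assms(3) by simp
  ultimately have j0_bounds: "2 \<le> j 0" "j 0 \<le> 2 * r - 1" unfolding j0 by linarith+
  have jS_bound: "j i \<le> 2 * r - 2" if "i > 0" for i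
  proof -
    have "real (j i) < 2 * real r - 1" using jS[OF that] assms(3) by linarith
    then show ?thesis by linarith
  qed
  \<comment> \<open>The midpoint of \<open>1\<close> and \<open>\<alpha>\<close> enters only to keep \<open>\<beta>\<close> above \<open>1\<close> when \<open>\<epsilon>\<close> is large.\<close>
  define \<beta> where "\<beta> = max (\<alpha> - \<epsilon> / 2) ((1 + \<alpha>) / 2)"
  have \<beta>: "1 < \<beta>" "\<beta> < \<alpha>" "\<alpha> - \<epsilon> < \<beta>"
    using assms(2,4) by (auto simp: \<beta>_def less_max_iff_disj)
  have "j 0 > 0" using j0_bounds by simp
  from ex_terminating_base[OF \<beta>(1,2) this small]
  obtain \<mu> n where \<mu>: "\<beta> \<le> \<mu>" "\<mu> \<le> \<alpha>" and zero: "remainder j \<mu> n = 0"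
    and pos: "\<And>i. i < n \<Longrightarrow> 0 < remainder j \<mu> i" by blast
  have \<mu>1: "\<mu> > 1" using \<mu> \<beta> by linarith
  \<comment> \<open>Any \<open>k\<close> will do for which the digits are less than \<open>2 ^ k\<close>.\<close>
  define k where "k = 2 * r"
  have jk: "j i < 2 ^ k" for i
  proof -
    have "j i < k" using j0_bounds jS_bound[of i] assms(1) by (cases "i = 0") (auto simp: k_def)
    also have "k < 2 ^ k" by (rule less_exp)
    finally show ?thesis .
  qed
  \<comment> \<open>A vertex of the last layer has only one neighbour in another layer, so its degree is at least \<open>2\<close>
    only if the last digit is not \<open>0\<close>. A carry is positive, so it needs a digit to cancel it.\<close>
  have jn: "j n > 0" if "n > 0"
  proof -
    obtain m where m: "n = Suc m" using \<open>n > 0\<close> gr0_implies_Suc by blast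
    have "carry \<mu> (remainder j \<mu> m) > 0" using \<mu>1 pos[of m] m by (intro carry_pos) auto
    then have "j n / (\<mu> + 1) > 0" using zero by (simp add: m)
    then show ?thesis by (cases "j n = 0") auto
  qed
  let ?G = "layered_graph k n j"
  have "pair_graph ?G" by (rule pair_graph_layered_graph) (rule jk)
  moreover have "pverts ?G \<noteq> {}" by (simp add: layered_graph_def lessThan_empty_iff)
  moreover have "out_degree (with_proj ?G) v \<in> {2..2 * r}" if "v \<in> pverts ?G" for v
  proof -
    from that obtain i x where v: "v = prod_encode (i, x)" "(i, x) \<in> {..n} \<times> {..<2 ^ k}"
      by (auto simp: layered_graph_def)
    have "out_degree (with_proj ?G) v = j i + (if i > 0 then 1 else 0) + (if i < n then 1 else 0)"
      unfolding v(1) out_degree_layered_graph[OF v(2)] by (rule card_layer_nbrs)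
    moreover have "i \<le> n" using v(2) by simp
    ultimately show ?thesis
      using j0_bounds jS_bound[of i] jn assms(1) by (cases "i = 0"; cases "i = n") auto
  qed
  moreover have "leading_eigenvalue (nb_matrix ?G) = \<mu>"
    using jk \<open>j 0 > 0\<close> \<mu>1 zero pos by (rule leading_eigenvalue_of_remainder)
  then have "\<bar>leading_eigenvalue (nb_matrix ?G) - \<alpha>\<bar> < \<epsilon>" using \<mu> \<beta>(3) by linarith
  ultimately show ?thesis by blast
qed

end
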